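(* For every integer $n\geq 2$, $$D_n(x)=\frac{1}{2}\sum_{k=1}^{n-1}R(n,k)x^k(1-x)^{n-1-k}.$$ Equivalently, for every integer $n\ge 2$, $$R_n(x)=2(1+x)^{n-1}D_n\left(\frac{x}{1+x}\right).$$
   Context: $\mathfrak{S}_n$ is the set of permutations $\pi=\pi(1)\cdots\pi(n)$ of $\{1,\ldots,n\}$. Alternating runs: $\pi$ changes direction at position $i\in\{2,\ldots,n-1\}$ if $\pi(i-1)<\pi(i)>\pi(i+1)$ or $\pi(i-1)>\pi(i)<\pi(i+1)$. For $n\ge 2$, $\pi$ has $k$ alternating runs if it changes direction at exactly $k-1$ positions; $R(n,k)$ is the number of $\pi\in\mathfrak{S}_n$ with $k$ alternating runs, and $R_n(x)=\sum_{k=1}^{n-1}R(n,k)x^k$. André permutations: $\pi\in\mathfrak{S}_n$ is an André permutation if (1) there is no $i\in\{2,\ldots,n-1\}$ with $\pi(i-1)>\pi(i)>\pi(i+1)$; and (2) for all $j,j'\in\{2,\ldots,n\}$ with $j<j'$, if $\pi(j-1)=\max\{\pi(j-1),\pi(j),\pi(j'-1),\pi(j')\}$ and $\pi(j')=\min\{\pi(j-1),\pi(j),\pi(j'-1),\pi(j')\}$, then there is $j''$ with $j<j''<j'$ and $\pi(j'')<\pi(j')$. An augmented André permutation is an André permutation with $\pi(n)=n$; $\mathfrak{A}_n$ is the set of augmented André permutations in $\mathfrak{S}_n$. A left peak of $\pi\in\mathfrak{S}_n$ is an index $i\in\{1,\ldots,n-1\}$ with $\pi(i-1)<\pi(i)>\pi(i+1)$,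 where $\pi(0)=0$. $d(n,k)$ is the number of permutations in $\mathfrak{A}_n$ with exactly $k-1$ left peaks, and $D_n(x)=\sum_{k\ge 1}d(n,k)x^k$. (For example $D_2(x)=x$, $D_3(x)=x+x^2$, $D_4(x)=x+4x^2$.) *)

theory Defs
  imports
    "HOL-Combinatorics.Permutations"
    "HOL-Computational_Algebra.Polynomial_Factorial"
begin

text \<open>
  A permutation of \<open>{1, \<dots>, n}\<close> is a function \<open>\<pi> :: nat \<Rightarrow> nat\<close> with
  \<open>\<pi> permutes {1..n}\<close>. Such a function is the identity outside \<open>{1..n}\<close>.
\<close>

definition direction_changes :: "nat \<Rightarrow> (nat \<Rightarrow> nat) \<Rightarrow> nat set" where
  "direction_changes n \<pi> =
     {i \<in> {2..n-1}. (\<pi> (i-1) < \<pi> i \<and> \<pi> i > \<pi> (i+1)) \<or> (\<pi> (i-1) > \<pi> i \<and> \<pi> i < \<pi> (i+1))}"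

text \<open>
  For \<open>n \<ge> 2\<close>, having \<open>k\<close> alternating runs means changing direction at exactly
  \<open>k - 1\<close> positions. Writing the condition with \<open>+ 1\<close> avoids truncated subtraction at \<open>k = 0\<close>.
\<close>

definition R_num :: "nat \<Rightarrow> nat \<Rightarrow> nat" where
  "R_num n k = card {\<pi>. \<pi> permutes {1..n} \<and> card (direction_changes n \<pi>) + 1 = k}"

definition R_poly :: "nat \<Rightarrow> rat poly" where
  "R_poly n = (\<Sum>k=1..n-1. monom (of_nat (R_num n k)) k)"

definition andre_permutation :: "nat \<Rightarrow> (nat \<Rightarrow> nat) \<Rightarrow> bool" where
  "andre_permutation n \<pi> \<longleftrightarrow>
     \<pi> permutes {1..n} \<and>
     \<not> (\<exists>i\<in>{2..n-1}. \<pi> (i-1) > \<pi> i \<and> \<pi> i > \<pi> (i+1)) \<and>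
     (\<forall>j\<in>{2..n}. \<forall>j'\<in>{2..n}.
        j < j' \<and>
        \<pi> (j-1) = Max {\<pi> (j-1), \<pi> j, \<pi> (j'-1), \<pi> j'} \<and>
        \<pi> j' = Min {\<pi> (j-1), \<pi> j, \<pi> (j'-1), \<pi> j'} \<longrightarrow>
        (\<exists>j''. j < j'' \<and> j'' < j' \<and> \<pi> j'' < \<pi> j'))"

definition augmented_andre_permutations :: "nat \<Rightarrow> (nat \<Rightarrow> nat) set" where
  "augmented_andre_permutations n = {\<pi>. andre_permutation n \<pi> \<and> \<pi> n = n}"

text \<open>
  The convention \<open>\<pi>(0) = 0\<close> holds automatically here, since a function that permutes
  \<open>{1..n}\<close> fixes \<open>0\<close>.
\<close>

definition left_peaks :: "nat \<Rightarrow> (nat \<Rightarrow> nat) \<Rightarrow> nat set" where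
  "left_peaks n \<pi> = {i \<in> {1..n-1}. \<pi> (i-1) < \<pi> i \<and> \<pi> i > \<pi> (i+1)}"

definition d_num :: "nat \<Rightarrow> nat \<Rightarrow> nat" where
  "d_num n k = card {\<pi> \<in> augmented_andre_permutations n. card (left_peaks n \<pi>) + 1 = k}"

text \<open>
  There are at most \<open>n - 1\<close> left peaks, so \<open>d_num n k = 0\<close> for \<open>k > n \<ge> 1\<close>, and the sum over all
  \<open>k \<ge> 1\<close> can be cut off at \<open>n\<close>.
\<close>

definition D_poly :: "nat \<Rightarrow> rat poly" where
  "D_poly n = (\<Sum>k=1..n. monom (of_nat (d_num n k)) k)"

text \<open>
  \<open>fract_X\<close> is the indeterminate of the field of rational functions over the rationals, and
  \<open>subst_fract p f\<close> is the result of substituting the rational function \<open>f\<close> for the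
  indeterminate of the polynomial \<open>p\<close>.
\<close>

definition fract_X :: "rat poly fract" where
  "fract_X = to_fract [:0, 1:]"

definition subst_fract :: "rat poly \<Rightarrow> rat poly fract \<Rightarrow> rat poly fract" where
  "subst_fract p f = poly (map_poly (\<lambda>c. to_fract [:c:]) p) f"

end

theory Submission
  imports Defs "HOL-Combinatorics.Multiset_Permutations"
begin

text \<open>
  Both sides satisfy the recurrence \<open>f(n+1) = (x - 2x^2) f(n)' + (n+1) x f(n)\<close>. For alternating runs,
  inserting a new maximum into a permutation of length \<open>n\<close> with \<open>k\<close> runs yields \<open>k\<close>, \<open>2\<close> and \<open>n-1-k\<close>
  permutations with \<open>k\<close>, \<open>k+1\<close> and \<open>k+2\<close> runs, and the recurrence already holds for the
  contribution \<open>x^k (1-x)^(n-1-k)\<close> of each single permutation. For Andre permutations, splitting an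
  augmented Andre word \<open>u m v\<close> at its minimum \<open>m\<close> gives two arbitrary augmented Andre words \<open>u\<close> and
  \<open>v\<close>, subject only to the maximum lying in \<open>v\<close>. The resulting quadratic recurrence holds for the
  solution of the linear one because the operator on the right-hand side obeys a product rule.
\<close>

subsection \<open>The recurrences\<close>

text \<open>The start value 1 belongs to the empty word, which occurs as the left part of a split at
  the minimum; the first step of the recurrence then gives x for a single letter.\<close>

primrec andre_poly :: "nat \<Rightarrow> rat poly" where
  "andre_poly 0 = 1"
| "andre_poly (Suc n) = [:0, 1, -2:] * pderiv (andre_poly n) + of_nat (n + 1) * [:0, 1:] * andre_poly n"

lemma pderiv_sum: "pderiv (\<Sum>x\<in>A. f x) = (\<Sum>x\<in>A. pderiv (f x))"
  by (induction A rule: infinite_finite_induct) (simp_all add: pderiv_add)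

text \<open>This is the recurrence produced by a split at the minimum: of the \<open>n\<close>
  letters other than minimum and maximum, \<open>j\<close> go left, and the others join the maximum
  on the right. In the induction step the operator has the factor n + 3 = (j + 1) + (n + 2 - j), the
  sum of the factors belonging to the two indices. So the product rule lets it act on f(j) and f(n +
  1 - j) one at a time, and Pascal's rule merges the two resulting sums.\<close>

lemma andre_poly_convolution:
  "andre_poly (n + 2) = (\<Sum>j\<le>n. of_nat (n choose j) * andre_poly j * andre_poly (n + 1 - j))"
proof (induction n)
  case 0
  show ?case
    by (simp add: numeral_2_eq_2 pderiv_pCons numeral_poly)
next
  case (Suc n)
  let ?f = andre_poly
  define E :: "rat poly" where "E = [:0, 1, -2:]"
  define X :: "rat poly" where "X = [:0, 1:]"
  have step: "?f (Suc k) = E * pderiv (?f k) + of_nat (k + 1) * X * ?f k" for k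
    by (simp add: E_def X_def)
  have split_term: "E * pderiv (?f j * ?f (n + 1 - j)) + of_nat (n + 3) * X * (?f j * ?f (n + 1 - j))
      = ?f (j + 1) * ?f (n + 1 - j) + ?f j * ?f (n + 2 - j)" if "j \<le> n" for j
  proof -
    obtain i where i: "n = j + i" using le_Suc_ex[OF \<open>j \<le> n\<close>] by blast
    have "n + 1 - j = Suc i" "n + 2 - j = Suc (Suc i)" "j + 1 = Suc j" by (simp_all add: i)
    moreover have "of_nat (n + 3) = (of_nat (j + 1) + of_nat (Suc i + 1) :: rat poly)"
      by (simp add: i)
    moreover have "?f (Suc j) * G + ?f j * (E * pderiv G + of_nat (Suc i + 1) * X * G) =
        E * pderiv (?f j * G) + (of_nat (j + 1) + of_nat (Suc i + 1)) * X * (?f j * G)" for G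
      unfolding step pderiv_mult by (simp only: distrib_left distrib_right mult.assoc add.assoc add.commute
          add.left_commute mult.commute mult.left_commute)
    ultimately show ?thesis by (simp only: step[of "Suc i"])
  qed
  have "?f (Suc n + 2) = E * pderiv (?f (n + 2)) + of_nat (n + 3) * X * ?f (n + 2)"
    using step[of "n + 2"] by (simp add: numeral_3_eq_3 del: andre_poly.simps)
  also have "\<dots> = (\<Sum>j\<le>n. of_nat (n choose j) *
      (E * pderiv (?f j * ?f (n + 1 - j)) + of_nat (n + 3) * X * (?f j * ?f (n + 1 - j))))"
  proof -
    have "E * pderiv (of_nat c * p * q) + a * (of_nat c * p * q) = of_nat c * (E * pderiv (p * q) + a * (p * q))"
      for c :: nat and p q a :: "rat poly"
      by (simp add: of_nat_poly pderiv_smult pderiv_mult algebra_simps smult_add_right)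
    then show ?thesis unfolding Suc.IH pderiv_sum
      by (simp only: sum_distrib_left sum.distrib[symmetric])
  qed
  also have "\<dots> = (\<Sum>j\<le>n. of_nat (n choose j) * (?f (j + 1) * ?f (n + 1 - j)))
      + (\<Sum>j\<le>n. of_nat (n choose j) * (?f j * ?f (n + 2 - j)))"
    unfolding sum.distrib[symmetric]
    by (rule sum.cong[OF refl]) (simp only: split_term atMost_iff distrib_left)
  \<comment> \<open>Since \<open>n choose Suc n\<close> is 0, the sum may run up to
    \<open>Suc n\<close>; splitting off j = 0 and shifting the index aligns its products with those
    of the first sum.\<close>
  also have "(\<Sum>j\<le>n. of_nat (n choose j) * (?f j * ?f (n + 2 - j)))
      = ?f (n + 2) + (\<Sum>j\<le>n. of_nat (n choose Suc j) * (?f (Suc j) * ?f (n + 1 - j)))"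
    using sum.atMost_Suc_shift[of "\<lambda>j. of_nat (n choose j) * (?f j * ?f (n + 2 - j))" n]
    by (simp add: binomial_eq_0)
  also have "(\<Sum>j\<le>n. of_nat (n choose j) * (?f (j + 1) * ?f (n + 1 - j))) +
      (?f (n + 2) + (\<Sum>j\<le>n. of_nat (n choose Suc j) * (?f (Suc j) * ?f (n + 1 - j))))
      = ?f (n + 2) + (\<Sum>j\<le>n. of_nat (Suc n choose Suc j) * (?f (Suc j) * ?f (n + 1 - j)))"
    by (simp add: sum.distrib algebra_simps del: andre_poly.simps)
  also have "\<dots> = (\<Sum>j\<le>Suc n. of_nat (Suc n choose j) * ?f j * ?f (Suc n + 1 - j))"
    by (subst sum.atMost_Suc_shift) (simp add: mult.assoc del: andre_poly.simps(2) binomial_Suc_Suc)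
  finally show ?case .
qed

text \<open>With Y = 1 - X the coefficient x - 2x^2 is X (Y - X), so the operator sends X^k Y^m to a
  combination of three neighbouring monomials. For a permutation of length n = k + m + 1 with k
  runs, the coefficients \<open>k\<close>, 2 and \<open>m\<close> count the insertions of a new
  maximum that add 0, 1 or 2 runs. The truncated \<open>m - 1\<close> is harmless at m = 0, where
  its coefficient vanishes.\<close>

lemma andre_poly_operator_term:
  fixes k m :: nat
  shows "[:0, 1, -2:] * pderiv ([:0, 1:] ^ k * [:1, -1:] ^ m)
      + of_nat (k + m + 2) * [:0, 1:] * ([:0, 1:] ^ k * [:1, -1:] ^ m) =
    of_nat k * ([:0, 1:] ^ k * [:1, -1:] ^ (m + 1)) + 2 * ([:0, 1:] ^ (k + 1) * [:1, -1:] ^ m)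
      + of_nat m * ([:0, 1:] ^ (k + 2) * [:1, -1 :: rat:] ^ (m - 1))"
proof -
  define X :: "rat poly" where "X = [:0, 1:]"
  define Y :: "rat poly" where "Y = [:1, -1:]"
  have XY: "[:0, 1, -2:] = X * (Y - X)" "Y = 1 - X" and d: "pderiv X = 1" "pderiv Y = -1"
    by (simp_all add: X_def Y_def pderiv_pCons one_pCons)
  have dX: "X * pderiv (X ^ k) = of_nat k * X ^ k"
    by (induction k) (simp_all add: pderiv_mult d algebra_simps)
  have "pderiv (Y ^ Suc k) = - of_nat (Suc k) * Y ^ k" for k
  proof (induction k)
    case (Suc k)
    have "pderiv (Y ^ Suc (Suc k)) = Y * pderiv (Y ^ Suc k) - Y ^ Suc k"
      by (subst power_Suc) (simp add: pderiv_mult d del: power_Suc)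
    then show ?case unfolding Suc.IH by (simp add: algebra_simps)
  qed (simp add: d)
  then have dY: "pderiv (Y ^ m) = - of_nat m * Y ^ (m - 1)"
    by (cases m) (simp_all del: power_Suc)
  have Ym: "of_nat m * Y ^ m = of_nat m * Y ^ (m - 1) * Y"
    by (cases m) simp_all
  have "X * (Y - X) * pderiv (X ^ k * Y ^ m) + of_nat (k + m + 2) * X * (X ^ k * Y ^ m)
      = (Y - X) * (X * pderiv (X ^ k)) * Y ^ m + X * (Y - X) * X ^ k * pderiv (Y ^ m)
        + of_nat (k + 2) * X * X ^ k * Y ^ m + X * X ^ k * (of_nat m * Y ^ m)"
    by (simp add: pderiv_mult algebra_simps)
  \<comment> \<open>The multiplier k + m + 2 is shared out: its part \<open>k\<close> turns the
    factor Y - X into Y, its part \<open>m\<close> turns X - Y into X, and 2 remains.\<close>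
  also have "\<dots> = of_nat k * X ^ k * Y ^ m * (Y - X + X) + 2 * X * X ^ k * Y ^ m
       + of_nat m * X * X ^ k * Y ^ (m - 1) * (X - Y + Y)"
    unfolding dX dY Ym by (simp add: algebra_simps)
  finally show ?thesis
    unfolding X_def[symmetric] Y_def[symmetric] XY(1) by (simp add: algebra_simps power2_eq_square)
qed

subsection \<open>Direction changes and insertion of the maximum\<close>

fun turns :: "nat list \<Rightarrow> nat" where
  "turns (a # b # c # w) = of_bool (a < b \<and> b > c \<or> a > b \<and> b < c) + turns (b # c # w)"
| "turns _ = 0"

lemma turns_le: "length w \<ge> 2 \<Longrightarrow> turns w + 2 \<le> length w"
  by (induction w rule: turns.induct) (auto simp: Suc_le_eq)

definition insert_at :: "nat \<Rightarrow> 'a \<Rightarrow> 'a list \<Rightarrow> 'a list" where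
  "insert_at i x w = take i w @ x # drop i w"

text \<open>Induction on the word: an insertion to the right of \<open>c\<close> affects only the
  word without \<open>a\<close>, and the turn at \<open>b\<close> is then a constant offset
  \<open>e\<close>. The weight \<open>g\<close> is arbitrary so that the induction hypothesis can be
  used for \<open>g\<close> shifted by \<open>e\<close>.\<close>

lemma sum_insert_max_nonfirst:
  fixes g :: "nat \<Rightarrow> 'a::comm_ring_1"
  assumes "\<forall>x\<in>set (a # b # w). x < M" "distinct (a # b # w)"
  shows "(\<Sum>i\<le>length w + 1. g (turns (insert_at (Suc i) M (a # b # w)))) =
    of_nat (turns (a # b # w) + of_bool (a < b)) * g (turns (a # b # w))
    + (if a < b then 1 else 2) * g (turns (a # b # w) + 1)
    + of_nat (length w - turns (a # b # w)) * g (turns (a # b # w) + 2)"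
  using assms
proof (induction w arbitrary: a b g)
  case Nil
  then show ?case by (auto simp: insert_at_def)
next
  case (Cons c w)
  define e :: nat where "e = of_bool (a < b \<and> b > c \<or> a > b \<and> b < c)"
  define t where "t = turns (b # c # w)"
  have lt: "a < M" "b < M" "c < M" and ne: "a \<noteq> b" "b \<noteq> c" using Cons.prems by auto
  have t: "turns (a # b # c # w) = e + t" by (simp add: e_def t_def)
  have tle: "t \<le> length w" using turns_le[of "b # c # w"] by (simp add: t_def)
  \<comment> \<open>Insertion between \<open>b\<close> and \<open>c\<close> is the one place where
    the offset \<open>e\<close> is wrong, because the right neighbour of \<open>b\<close> becomes
    \<open>M\<close>. Its term \<open>g (e + s)\<close> is therefore taken out of the induction
    hypothesis and replaced by the true one.\<close>
  define s where "s = turns (b # M # c # w)"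
  have "(\<Sum>i\<le>length w + 1. g (e + turns (insert_at (Suc i) M (b # c # w)))) =
      g (e + s) + (\<Sum>i\<le>length w. g (e + turns (insert_at (Suc (Suc i)) M (b # c # w))))"
    by (simp add: sum.atMost_Suc_shift insert_at_def s_def del: sum.atMost_Suc)
  moreover have "(\<Sum>i\<le>length (c # w) + 1. g (turns (insert_at (Suc i) M (a # b # c # w)))) =
      g (turns (a # M # b # c # w)) + (g (turns (a # b # M # c # w))
      + (\<Sum>i\<le>length w. g (e + turns (insert_at (Suc (Suc i)) M (b # c # w)))))"
    by (simp add: sum.atMost_Suc_shift insert_at_def e_def del: sum.atMost_Suc turns.simps)
      (simp add: turns.simps)
  ultimately have "(\<Sum>i\<le>length (c # w) + 1. g (turns (insert_at (Suc i) M (a # b # c # w)))) =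
      g (turns (a # M # b # c # w)) + g (turns (a # b # M # c # w)) - g (e + s)
      + (\<Sum>i\<le>length w + 1. g (e + turns (insert_at (Suc i) M (b # c # w))))"
    by simp
  also have "(\<Sum>i\<le>length w + 1. g (e + turns (insert_at (Suc i) M (b # c # w)))) =
      of_nat (t + of_bool (b < c)) * g (e + t) + (if b < c then 1 else 2) * g (e + (t + 1))
      + of_nat (length w - t) * g (e + (t + 2))"
    unfolding t_def using Cons.prems by (intro Cons.IH[of b c "\<lambda>k. g (e + k)"]) auto
  also have "turns (a # M # b # c # w) = 1 + of_bool (b < c) + t"
    using lt ne by (auto simp: t_def)
  also have "turns (a # b # M # c # w) = of_bool (a > b) + s"
    using lt ne by (auto simp: s_def)
  \<comment> \<open>For b < c the offset \<open>e\<close> equals \<open>of_bool (a > b)\<close>, so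
    the replaced term cancels. Only for b > c is the value of \<open>s\<close> needed: then
    \<open>M\<close> is a new peak, and the step down to \<open>c\<close> keeps its
    direction.\<close>
  also have "b > c \<Longrightarrow> s = 1 + t"
    using lt by (cases w) (auto simp: s_def t_def)
  then have "g (1 + of_bool (b < c) + t) + g (of_bool (a > b) + s) - g (e + s) +
     (of_nat (t + of_bool (b < c)) * g (e + t) + (if b < c then 1 else 2) * g (e + (t + 1))
      + of_nat (length w - t) * g (e + (t + 2))) =
    of_nat (e + t + of_bool (a < b)) * g (e + t)
    + (if a < b then 1 else 2) * g (e + t + 1)
    + of_nat (length (c # w) - (e + t)) * g (e + t + 2)"
    using ne tle by (auto simp: e_def algebra_simps Suc_diff_le not_less)
  finally show ?case unfolding t .
qed

text \<open>Insertion in front adds a turn exactly if the word starts with an ascent. This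
  additional term evens out the case distinction in \<open>sum_insert_max_nonfirst\<close>.\<close>

lemma sum_insert_max:
  fixes g :: "nat \<Rightarrow> 'a::comm_ring_1"
  assumes "\<forall>x\<in>set w. x < M" "distinct w" "length w \<ge> 2"
  shows "(\<Sum>i\<le>length w. g (turns (insert_at i M w))) =
    of_nat (turns w + 1) * g (turns w) + 2 * g (turns w + 1)
    + of_nat (length w - 2 - turns w) * g (turns w + 2)"
proof -
  obtain a b v where w: "w = a # b # v"
    using assms(3) by (metis Suc_le_length_iff numeral_2_eq_2)
  have "(\<Sum>i\<le>length w. g (turns (insert_at i M w))) = g (turns (M # w))
      + (\<Sum>i\<le>length v + 1. g (turns (insert_at (Suc i) M w)))"
    by (simp add: w sum.atMost_Suc_shift insert_at_def del: sum.atMost_Suc)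
  also have "turns (M # w) = of_bool (a < b) + turns w"
    using assms by (auto simp: w)
  finally show ?thesis
    using sum_insert_max_nonfirst[of a b v M g] assms by (auto simp: w algebra_simps)
qed

lemma sum_permutations_insert_max:
  fixes M :: nat
  assumes "finite A" "\<forall>x\<in>A. x < M"
  shows "(\<Sum>w\<in>permutations_of_set (insert M A). h w) =
    (\<Sum>w\<in>permutations_of_set A. \<Sum>i\<le>length w. h (insert_at i M w))"
proof -
  have M: "M \<notin> A" using assms(2) by blast
  let ?S = "SIGMA w:permutations_of_set A. {..length w}"
  have tw: "takeWhile (\<lambda>x. x \<noteq> M) (insert_at i M w) = take i w"
           "dropWhile (\<lambda>x. x \<noteq> M) (insert_at i M w) = M # drop i w"
    if "w \<in> permutations_of_set A" for i w
  proof -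
    have "\<forall>x\<in>set (take i w). x \<noteq> M"
      using that M by (auto dest!: in_set_takeD simp: permutations_of_set_def)
    then show "takeWhile (\<lambda>x. x \<noteq> M) (insert_at i M w) = take i w"
       "dropWhile (\<lambda>x. x \<noteq> M) (insert_at i M w) = M # drop i w"
      by (simp_all add: insert_at_def)
  qed
  \<comment> \<open>A word containing \<open>M\<close> once is determined by the word without
    \<open>M\<close> and the number of letters before \<open>M\<close>.\<close>
  have "(\<Sum>w\<in>permutations_of_set (insert M A). h w) = (\<Sum>(w, i)\<in>?S. h (insert_at i M w))"
  proof (rule sum.reindex_bij_witness[where
      j = "\<lambda>v. (takeWhile (\<lambda>x. x \<noteq> M) v @ tl (dropWhile (\<lambda>x. x \<noteq> M) v), length (takeWhile (\<lambda>x. x \<noteq> M) v))"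
      and i = "\<lambda>(w, i). insert_at i M w"])
    fix v assume v: "v \<in> permutations_of_set (insert M A)"
    then have "M \<in> set v" by (simp add: permutations_of_set_def)
    then obtain p q where pq: "v = p @ M # q" "M \<notin> set p"
      by (metis split_list_first)
    then have *: "takeWhile (\<lambda>x. x \<noteq> M) v = p" "dropWhile (\<lambda>x. x \<noteq> M) v = M # q"
      by (auto simp: takeWhile_append dropWhile_append)
    show "(case (takeWhile (\<lambda>x. x \<noteq> M) v @ tl (dropWhile (\<lambda>x. x \<noteq> M) v), length (takeWhile (\<lambda>x. x \<noteq> M) v)) of
       (w, i) \<Rightarrow> insert_at i M w) = v"
      unfolding * by (simp add: pq(1) insert_at_def)
    then show "(case (takeWhile (\<lambda>x. x \<noteq> M) v @ tl (dropWhile (\<lambda>x. x \<noteq> M) v), length (takeWhile (\<lambda>x. x \<noteq> M) v)) of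
       (w, i) \<Rightarrow> h (insert_at i M w)) = h v"
      by simp
    show "(takeWhile (\<lambda>x. x \<noteq> M) v @ tl (dropWhile (\<lambda>x. x \<noteq> M) v), length (takeWhile (\<lambda>x. x \<noteq> M) v)) \<in> ?S"
      unfolding * using v M by (auto simp: pq(1) permutations_of_set_def)
  next
    fix z assume "z \<in> ?S"
    then obtain w i where z: "z = (w, i)" and w: "w \<in> permutations_of_set A" and i: "i \<le> length w"
      by auto
    show "(takeWhile (\<lambda>x. x \<noteq> M) (case z of (w, i) \<Rightarrow> insert_at i M w)
        @ tl (dropWhile (\<lambda>x. x \<noteq> M) (case z of (w, i) \<Rightarrow> insert_at i M w)),
        length (takeWhile (\<lambda>x. x \<noteq> M) (case z of (w, i) \<Rightarrow> insert_at i M w))) = z"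
      using i by (simp add: z tw[OF w])
    have "set (take i w @ drop i w) = A" "distinct (take i w @ drop i w)"
      using w by (simp_all add: permutations_of_set_def)
    then show "(case z of (w, i) \<Rightarrow> insert_at i M w) \<in> permutations_of_set (insert M A)"
      unfolding z insert_at_def permutations_of_set_def using M
      by (auto simp del: append_take_drop_id)
  qed
  then show ?thesis
    using assms(1) by (simp add: sum.Sigma)
qed

text \<open>A word with k runs has \<open>turns w + 1 = k\<close>, so the exponent of 1 - x is n - 1
  - k. The operator is linear, hence the recurrence valid for every single word carries over to the
  sum. The factor 2 stems from the two words of length 2, each of weight x.\<close>

lemma run_sum_eq_andre_poly:
  "n \<ge> 2 \<Longrightarrow> (\<Sum>w\<in>permutations_of_set {1..n}. [:0, 1:] ^ (turns w + 1) * [:1, -1:] ^ (n - 2 - turns w))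
    = 2 * andre_poly n"
proof (induction n rule: dec_induct)
  case base
  have "{1..2} = {1, 2 :: nat}" by auto
  then have "permutations_of_set {1..2} = {[1, 2], [2, 1 :: nat]}"
    by (auto simp: permutations_of_set_doubleton)
  then show ?case
    by (simp add: numeral_2_eq_2 pderiv_pCons numeral_poly)
next
  case (step n)
  define X :: "rat poly" where "X = [:0, 1:]"
  define Y :: "rat poly" where "Y = [:1, -1:]"
  let ?g = "\<lambda>t. X ^ (t + 1) * Y ^ (n - 1 - t)"
  let ?L = "\<lambda>p. [:0, 1, -2:] * pderiv p + of_nat (n + 1) * X * p"
  have "(\<Sum>w\<in>permutations_of_set {1..Suc n}. X ^ (turns w + 1) * Y ^ (Suc n - 2 - turns w))
     = (\<Sum>w\<in>permutations_of_set (insert (Suc n) {1..n}). ?g (turns w))"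
    by (simp add: atLeastAtMostSuc_conv)
  also have "\<dots> = (\<Sum>w\<in>permutations_of_set {1..n}. \<Sum>i\<le>length w. ?g (turns (insert_at i (Suc n) w)))"
    by (rule sum_permutations_insert_max) auto
  also have "\<dots> = (\<Sum>w\<in>permutations_of_set {1..n}. ?L (X ^ (turns w + 1) * Y ^ (n - 2 - turns w)))"
  proof (rule sum.cong[OF refl])
    fix w assume "w \<in> permutations_of_set {1..n}"
    then have w: "set w = {1..n}" "distinct w" "length w = n"
      by (auto simp: permutations_of_set_def dest: distinct_card)
    define m where "m = n - 2 - turns w"
    have n: "n = turns w + m + 2" using turns_le[of w] w step.hyps by (simp add: m_def)
    have "(\<Sum>i\<le>length w. ?g (turns (insert_at i (Suc n) w))) =
        of_nat (turns w + 1) * ?g (turns w) + 2 * ?g (turns w + 1)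
        + of_nat (length w - 2 - turns w) * ?g (turns w + 2)"
      using w step.hyps by (intro sum_insert_max) auto
    also have "\<dots> = of_nat (turns w + 1) * (X ^ (turns w + 1) * Y ^ (m + 1))
        + 2 * (X ^ (turns w + 1 + 1) * Y ^ m) + of_nat m * (X ^ (turns w + 1 + 2) * Y ^ (m - 1))"
      using n w(3) by simp
    also have "\<dots> = [:0, 1, -2:] * pderiv (X ^ (turns w + 1) * Y ^ m)
        + of_nat (turns w + 1 + m + 2) * X * (X ^ (turns w + 1) * Y ^ m)"
      unfolding X_def Y_def by (rule andre_poly_operator_term[symmetric])
    also have "turns w + 1 + m + 2 = n + 1" using n by simp
    finally show "(\<Sum>i\<le>length w. ?g (turns (insert_at i (Suc n) w))) = ?L (X ^ (turns w + 1) * Y ^ (n - 2 - turns w))"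
      by (simp add: m_def)
  qed
  also have "\<dots> = ?L (\<Sum>w\<in>permutations_of_set {1..n}. X ^ (turns w + 1) * Y ^ (n - 2 - turns w))"
    by (simp only: pderiv_sum sum_distrib_left sum.distrib)
  also have "\<dots> = ?L (2 * andre_poly n)"
    using step.IH by (simp add: X_def Y_def)
  also have "\<dots> = 2 * andre_poly (Suc n)"
    by (simp add: pderiv_mult X_def algebra_simps)
  finally show ?case by (simp add: X_def Y_def)
qed

subsection \<open>Andre words\<close>

text \<open>
  The word form of augmented Andre permutations of an arbitrary set. The condition excluding
  double descents is omitted: it is the case \<open>j = i + 1\<close> of the other one.
\<close>

definition andre_word :: "nat list \<Rightarrow> bool" where
  "andre_word w \<longleftrightarrow>
     (\<forall>i j. i < j \<and> Suc j < length w \<and> w ! Suc i \<le> w ! i \<and> w ! j \<le> w ! i \<and> w ! Suc j \<le> w ! i \<and>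
        w ! Suc j \<le> w ! Suc i \<and> w ! Suc j \<le> w ! j \<longrightarrow> (\<exists>l. Suc i < l \<and> l \<le> j \<and> w ! l < w ! Suc j)) \<and>
     (\<forall>x\<in>set w. x \<le> last w)"

lemma andre_word_nthD:
  assumes "andre_word w" "i < j" "Suc j < length w" "w ! Suc i \<le> w ! i" "w ! j \<le> w ! i"
    "w ! Suc j \<le> w ! i" "w ! Suc j \<le> w ! Suc i" "w ! Suc j \<le> w ! j"
  obtains l where "Suc i < l" "l \<le> j" "w ! l < w ! Suc j"
  using assms unfolding andre_word_def by blast

text \<open>A pair of positions on both sides of \<open>m\<close> always has \<open>m\<close> itself
  as witness, so only conditions inside \<open>u\<close> and inside \<open>v\<close> survive. The
  descent into \<open>m\<close> can have no witness below \<open>m\<close>, which forces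
  \<open>u\<close> to end in its maximum; the maximum of the whole word being last puts
  \<open>M\<close> at the end of \<open>v\<close>.\<close>

lemma andre_word_split_min:
  assumes dist: "distinct (u @ m # v)" and min: "\<forall>x\<in>set u \<union> set v. m < x"
    and max: "\<forall>x\<in>set u \<union> set v. x \<le> M" "M \<in> set u \<union> set v"
  shows "andre_word (u @ m # v) \<longleftrightarrow> andre_word u \<and> andre_word v \<and> M \<in> set v"
proof (intro iffI conjI)
  let ?w = "u @ m # v"
  assume A: "andre_word ?w"
  have nu: "?w ! i = u ! i" if "i < length u" for i using that by (simp add: nth_append)
  have nv: "?w ! (i + length u + 1) = v ! i" for i by (simp add: nth_append)
  have nm: "?w ! length u = m" by simp
  have "M \<le> last ?w" using A max(2) by (auto simp: andre_word_def)
  moreover have "m < M" using min max(2) by blast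
  ultimately have vM: "v \<noteq> []" "last v = M"
    using max(1) by (auto split: if_splits intro: antisym)
  then show "M \<in> set v" by auto
  show "andre_word v"
    unfolding andre_word_def
  proof (intro conjI allI impI ballI)
    fix i j assume H: "i < j \<and> Suc j < length v \<and> v ! Suc i \<le> v ! i \<and> v ! j \<le> v ! i \<and> v ! Suc j \<le> v ! i \<and>
        v ! Suc j \<le> v ! Suc i \<and> v ! Suc j \<le> v ! j"
    obtain l where l: "Suc (i + length u + 1) < l" "l \<le> j + length u + 1" "?w ! l < ?w ! Suc (j + length u + 1)"
      by (rule andre_word_nthD[OF A, of "i + length u + 1" "j + length u + 1"])
        (use H nv[of i] nv[of j] nv[of "Suc i"] nv[of "Suc j"] in auto)
    then have "v ! (l - (length u + 1)) < v ! Suc j"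
      using nv[of "Suc j"] nv[of "l - (length u + 1)"] by simp
    then show "\<exists>l. Suc i < l \<and> l \<le> j \<and> v ! l < v ! Suc j"
      using l by (intro exI[of _ "l - (length u + 1)"]) auto
  qed (use vM max(1) in auto)
  show "andre_word u"
    unfolding andre_word_def
  proof (intro conjI allI impI ballI)
    fix i j assume H: "i < j \<and> Suc j < length u \<and> u ! Suc i \<le> u ! i \<and> u ! j \<le> u ! i \<and> u ! Suc j \<le> u ! i \<and>
        u ! Suc j \<le> u ! Suc i \<and> u ! Suc j \<le> u ! j"
    obtain l where l: "Suc i < l" "l \<le> j" "?w ! l < ?w ! Suc j"
      by (rule andre_word_nthD[OF A, of i j]) (use H in \<open>auto simp: nu\<close>)
    then show "\<exists>l. Suc i < l \<and> l \<le> j \<and> u ! l < u ! Suc j"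
      using H by (intro exI[of _ l]) (auto simp: nu)
  next
    fix x assume x: "x \<in> set u"
    define y where "y = Max (set u)"
    have y: "y \<in> set u" "\<forall>z\<in>set u. z \<le> y"
      using x by (auto simp: y_def intro: Max_in)
    obtain i where i: "i < length u" "u ! i = y" using y(1) by (auto simp: in_set_conv_nth)
    have "\<not> Suc i < length u"
    proof
      assume i': "Suc i < length u"
      \<comment> \<open>If the maximum \<open>y\<close> of \<open>u\<close> were not last, the step
        after \<open>y\<close> and the step into \<open>m\<close> would form a pair whose witness is
        a letter of \<open>u\<close> below \<open>m\<close>.\<close>
      define j where "j = length u - 1"
      have j: "i < j" "Suc j = length u" using i' by (auto simp: j_def)
      have mem: "u ! Suc i \<in> set u" "u ! j \<in> set u" using i' j by auto
      have mm: "\<forall>z\<in>set u. m \<le> z" using min less_imp_le by blast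
      have ws: "?w ! i = y" "?w ! Suc i = u ! Suc i" "?w ! j = u ! j" "?w ! Suc j = m"
        using i i' j by (auto simp: nu nm)
      obtain l where l: "Suc i < l" "l \<le> j" "?w ! l < ?w ! Suc j"
        by (rule andre_word_nthD[OF A j(1)]) (use y mem mm j in \<open>auto simp only: ws, auto\<close>)
      have "u ! l \<in> set u" using l j by auto
      then have "m < u ! l" using min by blast
      then show False using l j ws nu[of l] by auto
    qed
    then have "last u = y" using i by (metis Suc_lessI diff_Suc_1 last_conv_nth list.size(3) not_less_zero)
    then show "x \<le> last u" using x y by simp
  qed
next
  let ?w = "u @ m # v"
  assume A: "andre_word u \<and> andre_word v \<and> M \<in> set v"
  then have Au: "andre_word u" and Av: "andre_word v" and Mv: "M \<in> set v" by auto
  have nu: "?w ! i = u ! i" if "i < length u" for i using that by (simp add: nth_append)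
  have nv: "?w ! (i + length u + 1) = v ! i" for i by (simp add: nth_append)
  have nm: "?w ! length u = m" by simp
  have mle: "m \<le> ?w ! i" if "i < length ?w" for i
    using that min nth_mem[OF that] by (auto simp del: nth_mem intro: less_imp_le)
  have meq: "i = length u" if "i < length ?w" "?w ! i \<le> m" for i
    using nth_eq_iff_index_eq[OF dist that(1), of "length u"] mle[OF that(1)] that by simp
  have last: "last v = M" using Mv Av max(1) by (metis Un_iff andre_word_def antisym empty_iff last_in_set list.set(1))
  show "andre_word ?w"
    unfolding andre_word_def
  proof (intro conjI allI impI ballI)
    fix i j assume H: "i < j \<and> Suc j < length ?w \<and> ?w ! Suc i \<le> ?w ! i \<and> ?w ! j \<le> ?w ! i \<and> ?w ! Suc j \<le> ?w ! i \<and>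
        ?w ! Suc j \<le> ?w ! Suc i \<and> ?w ! Suc j \<le> ?w ! j"
    \<comment> \<open>Only three cases can occur: both steps in \<open>u\<close>, both in
      \<open>v\<close>, or one on each side of \<open>m\<close>. A step touching \<open>m\<close>
      contradicts the hypotheses, which would place the minimum at a second position; a step at the
      end of \<open>u\<close> contradicts that \<open>last u\<close> is the maximum of
      \<open>u\<close>.\<close>
    consider "Suc j < length u" | "Suc j = length u" | "j = length u" | "i = length u" | "Suc i = length u"
      | "Suc i < length u" "length u < j" | "length u < i"
      using H by linarith
    then show "\<exists>l. Suc i < l \<and> l \<le> j \<and> ?w ! l < ?w ! Suc j"
    proof cases
      case 1
      obtain l where l: "Suc i < l" "l \<le> j" "u ! l < u ! Suc j"
        by (rule andre_word_nthD[OF Au, of i j]) (use H 1 in \<open>auto simp: nu\<close>)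
      then show ?thesis using 1 by (intro exI[of _ l]) (auto simp: nu)
    next
      case 2
      then have "?w ! j = last u"
        using nu[of j] by (metis diff_Suc_1 last_conv_nth lessI list.size(3) nat.simps(3))
      moreover have "?w ! i \<le> last u"
        using Au H 2 nu[of i] by (auto simp: andre_word_def)
      ultimately have "?w ! i = ?w ! j" using H by linarith
      then have "i = j" using nth_eq_iff_index_eq[OF dist, of i j] H by simp
      then show ?thesis using H by simp
    next
      case 3
      then have "Suc j = length u" using H by (intro meq) simp_all
      then show ?thesis using 3 by simp
    next
      case 4
      then have "?w ! Suc i \<le> m" using H by simp
      then have "Suc i = length u" using H by (intro meq) simp_all
      then show ?thesis using 4 by simp
    next
      case 5
      then have "?w ! Suc i = m" by simp
      then have "Suc j = length u" using H by (intro meq) simp_all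
      then show ?thesis using H 5 by simp
    next
      case 6
      then have "?w ! Suc j \<noteq> m" using nth_eq_iff_index_eq[OF dist, of "Suc j" "length u"] H by simp
      then have "m < ?w ! Suc j" using mle[of "Suc j"] H by simp
      then show ?thesis using 6 nm by (intro exI[of _ "length u"]) auto
    next
      case 7
      define i' j' where ij: "i' = i - (length u + 1)" "j' = j - (length u + 1)"
      have e: "i = i' + length u + 1" "j = j' + length u + 1" using 7 H by (auto simp: ij)
      obtain l where l: "Suc i' < l" "l \<le> j'" "v ! l < v ! Suc j'"
        by (rule andre_word_nthD[OF Av, of i' j'])
          (use H nv[of i'] nv[of j'] nv[of "Suc i'"] nv[of "Suc j'"] in \<open>auto simp: e\<close>)
      then show ?thesis using nv[of l] nv[of "Suc j'"]
        by (intro exI[of _ "l + length u + 1"]) (auto simp: e)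
    qed
  next
    fix x assume "x \<in> set ?w"
    moreover have "m \<le> M" using min max(2) by (auto intro: less_imp_le)
    moreover have "last ?w = M" using last Mv by auto
    ultimately show "x \<le> last ?w" using max(1) by auto
  qed
qed

section \<open>Descents and the generating polynomial of Andre words\<close>

fun descents :: "nat list \<Rightarrow> nat" where
  "descents (a # b # w) = of_bool (a > b) + descents (b # w)"
| "descents _ = 0"

lemma descents_split_min:
  "\<forall>x\<in>set u \<union> set v. m < x \<Longrightarrow> descents (u @ m # v) = descents u + of_bool (u \<noteq> []) + descents v"
  by (induction u rule: descents.induct) (cases v; auto)+

definition andre_words :: "nat set \<Rightarrow> nat list set" where
  "andre_words X = {w \<in> permutations_of_set X. andre_word w}"

text \<open>
  Splitting repeatedly at the minimum turns an Andre word into an increasing binary tree whose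
  number of leaves is the number of descents plus one. The empty tree has no leaves.
\<close>

definition leaf_weight :: "nat list \<Rightarrow> rat poly" where
  "leaf_weight w = (if w = [] then 1 else [:0, 1:] ^ (descents w + 1))"

text \<open>If \<open>u\<close> is nonempty, the descent into \<open>m\<close> supplies the
  additional 1 in its exponent; if \<open>u\<close> is empty, its weight is 1. An empty
  \<open>v\<close> would break the formula, as \<open>m\<close> would then be a leaf or end a
  descent unaccounted for.\<close>

lemma leaf_weight_split_min:
  assumes "\<forall>x\<in>set u \<union> set v. m < x" "v \<noteq> []"
  shows "leaf_weight (u @ m # v) = leaf_weight u * leaf_weight v"
  using assms by (simp add: leaf_weight_def descents_split_min power_add)

lemma finite_andre_words [simp]: "finite X \<Longrightarrow> finite (andre_words X)"
  by (simp add: andre_words_def)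

text \<open>Cutting at \<open>m\<close> is a bijection onto pairs of Andre words, where
  \<open>M\<close> must go right and any subset \<open>U\<close> of the other letters may go left.
  Keeping \<open>U\<close> as a component of the triple makes the sum factor for each
  \<open>U\<close>.\<close>

lemma sum_andre_words_split_min:
  assumes "finite X" "m < M" "\<forall>x\<in>X. m < x \<and> x < M"
  shows "(\<Sum>w\<in>andre_words (insert m (insert M X)). leaf_weight w) =
    (\<Sum>U\<in>Pow X. (\<Sum>u\<in>andre_words U. leaf_weight u) * (\<Sum>v\<in>andre_words (insert M (X - U)). leaf_weight v))"
proof -
  let ?S = "SIGMA U:Pow X. andre_words U \<times> andre_words (insert M (X - U))"
  let ?l = "takeWhile (\<lambda>x. x \<noteq> m)" and ?r = "\<lambda>w. tl (dropWhile (\<lambda>x. x \<noteq> m) w)"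
  have split: "?l (u @ m # v) = u" "?r (u @ m # v) = v" if "m \<notin> set u" for u v
    using that by (auto simp: takeWhile_append dropWhile_append)
  have mM: "m \<notin> X" "M \<notin> X" using assms by auto
  have "(\<Sum>w\<in>andre_words (insert m (insert M X)). leaf_weight w) = (\<Sum>(U, u, v)\<in>?S. leaf_weight u * leaf_weight v)"
  proof (rule sum.reindex_bij_witness[where
      j = "\<lambda>w. (set (?l w), ?l w, ?r w)" and i = "\<lambda>(U, u, v). u @ m # v"])
    fix w assume "w \<in> andre_words (insert m (insert M X))"
    then have w: "set w = insert m (insert M X)" "distinct w" "andre_word w"
      by (auto simp: andre_words_def permutations_of_set_def)
    then obtain u v where uv: "w = u @ m # v" "m \<notin> set u"
      by (metis insertI1 split_list_first)
    note lr = split[OF uv(2), of v, folded uv(1)]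
    have set: "set u \<union> set v = insert M X"
    proof -
      have "insert m (set u \<union> set v) = insert m (insert M X)" using w(1) by (simp add: uv(1))
      moreover have "m \<notin> set u \<union> set v" "m \<notin> insert M X" using w(2) mM assms(2) by (simp_all add: uv(1))
      ultimately show ?thesis by (metis insert_ident)
    qed
    have a: "andre_word u \<and> andre_word v \<and> M \<in> set v"
      using w(2,3) set assms by (subst andre_word_split_min[symmetric, of u m v M]) (auto simp: uv(1))
    have "set v = insert M (X - set u)" "set u \<subseteq> X" using set a w(2) mM by (auto simp: uv(1))
    then show "(set (?l w), ?l w, ?r w) \<in> ?S"
      using a w(2) unfolding lr by (auto simp: andre_words_def permutations_of_set_def uv(1))
    show "(case (set (?l w), ?l w, ?r w) of (U, u, v) \<Rightarrow> u @ m # v) = w"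
      unfolding lr by (simp add: uv(1))
    have "leaf_weight w = leaf_weight u * leaf_weight v"
      unfolding uv(1) using a assms by (intro leaf_weight_split_min) (auto simp: set)
    then show "(case (set (?l w), ?l w, ?r w) of (U, u, v) \<Rightarrow> leaf_weight u * leaf_weight v) = leaf_weight w"
      unfolding lr by simp
  next
    fix z assume "z \<in> ?S"
    then obtain u v where z: "z = (set u, u, v)" "set u \<subseteq> X" "distinct u" "distinct v" "set v = insert M (X - set u)"
       "andre_word u" "andre_word v"
      by (auto simp: andre_words_def permutations_of_set_def)
    have "m \<notin> set u" using z(2) mM by blast
    note lr = split[OF this, of v]
    show "(set (?l (case z of (U, u, v) \<Rightarrow> u @ m # v)), ?l (case z of (U, u, v) \<Rightarrow> u @ m # v),
       ?r (case z of (U, u, v) \<Rightarrow> u @ m # v)) = z"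
      unfolding z(1) prod.case lr ..
    have set: "set u \<union> set v = insert M X" using z by auto
    have dist: "distinct (u @ m # v)" using z mM assms(2) by auto
    have "andre_word (u @ m # v)"
    proof -
      have "\<forall>x\<in>set u \<union> set v. m < x \<and> x \<le> M"
        unfolding set using assms by (auto intro: less_imp_le)
      then show ?thesis using z dist by (subst andre_word_split_min[of u m v M]) auto
    qed
    then show "(case z of (U, u, v) \<Rightarrow> u @ m # v) \<in> andre_words (insert m (insert M X))"
      using dist set by (auto simp: z(1) andre_words_def permutations_of_set_def)
  qed
  also have "\<dots> = (\<Sum>U\<in>Pow X. \<Sum>(u, v)\<in>andre_words U \<times> andre_words (insert M (X - U)). leaf_weight u * leaf_weight v)"
  proof (rule sum.Sigma[symmetric])
    show "\<forall>U\<in>Pow X. finite (andre_words U \<times> andre_words (insert M (X - U)))"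
      using assms(1) by (auto dest: finite_subset)
  qed (use assms(1) in simp)
  finally show ?thesis
    by (simp add: sum_product sum.cartesian_product)
qed

lemma sum_Pow_card:
  fixes h :: "nat \<Rightarrow> 'a::comm_semiring_1"
  assumes "finite X"
  shows "(\<Sum>U\<in>Pow X. h (card U)) = (\<Sum>j\<le>card X. of_nat (card X choose j) * h j)"
proof -
  have "(\<Sum>U\<in>Pow X. h (card U)) = (\<Sum>j\<le>card X. \<Sum>U\<in>{U \<in> Pow X. card U = j}. h (card U))"
    using assms by (intro sum.group[symmetric]) (auto intro: card_mono)
  also have "\<dots> = (\<Sum>j\<le>card X. of_nat (card X choose j) * h j)"
    using assms by (intro sum.cong) (auto simp: n_subsets)
  finally show ?thesis .
qed

text \<open>Strong induction on the size: both parts of a split are smaller, so their sums depend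
  only on their sizes, and the sum over subsets becomes the binomial convolution of
  \<open>andre_poly\<close>. Sizes 0 and 1 are separate because the split needs distinct minimum and
  maximum.\<close>

lemma sum_andre_words:
  "finite X \<Longrightarrow> (\<Sum>w\<in>andre_words X. leaf_weight w) = andre_poly (card X)"
proof (induction "card X" arbitrary: X rule: less_induct)
  case less
  consider "card X = 0" | "card X = 1" | n where "card X = n + 2"
    by (metis One_nat_def add_2_eq_Suc' not0_implies_Suc)
  then show ?case
  proof cases
    case 1
    then have "X = {}" using less.prems by simp
    moreover have "andre_words {} = {[]}" by (auto simp: andre_words_def andre_word_def)
    ultimately show ?thesis by (simp add: leaf_weight_def)
  next
    case 2
    then obtain x where "X = {x}" by (rule card_1_singletonE)
    moreover have "andre_words {x} = {[x]}" by (auto simp: andre_words_def andre_word_def)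
    ultimately show ?thesis by (simp add: leaf_weight_def)
  next
    case 3
    have ne: "X \<noteq> {}" using 3 by auto
    define m M where mM: "m = Min X" "M = Max X"
    define Y where "Y = X - {m, M}"
    have mX: "m \<in> X" "M \<in> X" "\<forall>x\<in>X. m \<le> x \<and> x \<le> M" using less.prems ne by (auto simp: mM)
    have "m \<noteq> M"
    proof
      assume "m = M"
      then have "X \<subseteq> {m}" using mX(3) by (auto intro: antisym)
      then show False using card_mono[of "{m}" X] 3 by simp
    qed
    then have lt: "m < M" using mX by (simp add: order.not_eq_order_implies_strict)
    have X: "X = insert m (insert M Y)" using mX by (auto simp: Y_def)
    have Y: "finite Y" "\<forall>x\<in>Y. m < x \<and> x < M"
      using less.prems mX(3) by (auto simp: Y_def order.strict_iff_order)
    have cY: "card Y = n" using 3 less.prems mX lt by (simp add: Y_def card_Diff_subset)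
    have "(\<Sum>w\<in>andre_words X. leaf_weight w) =
      (\<Sum>U\<in>Pow Y. (\<Sum>u\<in>andre_words U. leaf_weight u) * (\<Sum>v\<in>andre_words (insert M (Y - U)). leaf_weight v))"
      unfolding X using Y lt by (intro sum_andre_words_split_min) auto
    also have "\<dots> = (\<Sum>U\<in>Pow Y. andre_poly (card U) * andre_poly (n + 1 - card U))"
    proof (rule sum.cong[OF refl])
      fix U assume "U \<in> Pow Y"
      then have U: "U \<subseteq> Y" "finite U" "card U \<le> n" using Y(1) cY by (auto intro: finite_subset card_mono)
      have "card (insert M (Y - U)) = n + 1 - card U"
        using Y U cY by (subst card_insert_disjoint) (auto simp: card_Diff_subset Suc_diff_le)
      then show "(\<Sum>u\<in>andre_words U. leaf_weight u) * (\<Sum>v\<in>andre_words (insert M (Y - U)). leaf_weight v)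
          = andre_poly (card U) * andre_poly (n + 1 - card U)"
        using less.hyps[of U] less.hyps[of "insert M (Y - U)"] U Y(1) 3 by simp
    qed
    also have "\<dots> = (\<Sum>j\<le>n. of_nat (n choose j) * andre_poly j * andre_poly (n + 1 - j))"
      using sum_Pow_card[OF Y(1), of "\<lambda>j. andre_poly j * andre_poly (n + 1 - j)"]
      by (simp add: cY mult.assoc del: andre_poly.simps)
    finally show ?thesis by (simp add: 3 andre_poly_convolution del: andre_poly.simps flip: add_2_eq_Suc')
  qed
qed

subsection \<open>Permutations as words\<close>

lemma sum_permutes_words:
  "(\<Sum>\<pi>\<in>{\<pi>. \<pi> permutes {1..n}}. h (map \<pi> [1..<Suc n])) = (\<Sum>w\<in>permutations_of_set {1..n}. h w)"
proof (rule sum.reindex_bij_betw)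
  let ?F = "\<lambda>\<pi>. map \<pi> [1..<Suc n]" and ?P = "{\<pi>. \<pi> permutes {1..n}}"
  have inj: "inj_on ?F ?P"
  proof (rule inj_onI, rule ext)
    fix \<pi> \<sigma> x assume "\<pi> \<in> ?P" "\<sigma> \<in> ?P" "?F \<pi> = ?F \<sigma>"
    then show "\<pi> x = \<sigma> x"
      by (cases "x \<in> {1..n}") (auto simp: permutes_not_in simp del: upt_Suc)
  qed
  have "?F ` ?P \<subseteq> permutations_of_set {1..n}"
    by (auto simp: permutations_of_set_def distinct_map permutes_inj_on permutes_image
        atLeastLessThanSuc_atLeastAtMost simp del: upt_Suc)
  \<comment> \<open>Surjectivity follows by counting, both sets having n! elements.\<close>
  then have "?F ` ?P = permutations_of_set {1..n}"
    using inj by (intro card_subset_eq) (simp_all add: card_image card_permutations)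
  then show "bij_betw ?F ?P (permutations_of_set {1..n})"
    using inj by (simp add: bij_betw_def)
qed

lemma turns_eq_sum:
  "turns w = (\<Sum>i<length w - 2. of_bool (w ! i < w ! Suc i \<and> w ! Suc i > w ! Suc (Suc i) \<or>
     w ! i > w ! Suc i \<and> w ! Suc i < w ! Suc (Suc i)))"
  by (induction w rule: turns.induct) (simp_all add: sum.lessThan_Suc_shift del: sum.lessThan_Suc)

lemma card_direction_changes:
  "card (direction_changes n \<pi>) = turns (map \<pi> [1..<Suc n])"
proof -
  let ?P = "\<lambda>i. \<pi> (i + 1) < \<pi> (i + 2) \<and> \<pi> (i + 2) > \<pi> (i + 3) \<or> \<pi> (i + 1) > \<pi> (i + 2) \<and> \<pi> (i + 2) < \<pi> (i + 3)"
  \<comment> \<open>Position i = k + 2 is the middle of the three letters with list indices k, k +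
    1, k + 2.\<close>
  have "direction_changes n \<pi> = (\<lambda>i. i + 2) ` ({..<n - 2} \<inter> {i. ?P i})"
  proof (intro set_eqI iffI)
    fix i assume "i \<in> direction_changes n \<pi>"
    moreover from this obtain k where "i = k + 2" by (auto simp: direction_changes_def dest: le_Suc_ex)
    ultimately show "i \<in> (\<lambda>i. i + 2) ` ({..<n - 2} \<inter> {i. ?P i})"
      by (auto simp: direction_changes_def numeral_3_eq_3)
  qed (auto simp: direction_changes_def numeral_3_eq_3)
  then have "card (direction_changes n \<pi>) = card ({..<n - 2} \<inter> {i. ?P i})"
    by (simp only:) (rule card_image, simp add: inj_on_def)
  also have "\<dots> = (\<Sum>i<n - 2. of_bool (?P i))"
    by (subst sum_of_bool_eq) simp_all
  also have "\<dots> = turns (map \<pi> [1..<Suc n])"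
    unfolding turns_eq_sum by (intro sum.cong) (simp_all add: numeral_3_eq_3 del: upt_Suc)
  finally show ?thesis .
qed

lemma descents_eq_sum: "descents w = (\<Sum>i<length w - 1. of_bool (w ! i > w ! Suc i))"
  by (induction w rule: descents.induct) (simp_all add: sum.lessThan_Suc_shift del: sum.lessThan_Suc)

lemma card_left_peaks:
  assumes "andre_permutation n \<pi>"
  shows "card (left_peaks n \<pi>) = descents (map \<pi> [1..<Suc n])"
proof -
  have perm: "\<pi> permutes {1..n}" using assms by (simp add: andre_permutation_def)
  \<comment> \<open>Without double descents every descent starts at a left peak; at the first
    position this uses the convention that 0 precedes the word.\<close>
  have asc: "\<pi> (i - 1) < \<pi> i" if i: "i \<in> {1..n-1}" "\<pi> i > \<pi> (i + 1)" for i
  proof (cases "i = 1")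
    case True
    have "\<pi> 0 = 0" using perm by (simp add: permutes_not_in)
    moreover have "\<pi> 1 \<in> {1..n}" using perm i by (subst permutes_in_image) auto
    ultimately show ?thesis by (simp add: True)
  next
    case False
    then have "i \<in> {2..n-1}" using i by auto
    then have "\<not> \<pi> (i - 1) > \<pi> i" using assms i(2) by (auto simp: andre_permutation_def)
    moreover have "\<pi> (i - 1) \<noteq> \<pi> i"
      using permutes_inj[OF perm, THEN injD, of "i - 1" i] i by auto
    ultimately show ?thesis by simp
  qed
  have "left_peaks n \<pi> = Suc ` ({..<n - 1} \<inter> {i. \<pi> (i + 1) > \<pi> (i + 2)})"
  proof (intro set_eqI iffI)
    fix i assume "i \<in> left_peaks n \<pi>"
    then show "i \<in> Suc ` ({..<n - 1} \<inter> {i. \<pi> (i + 1) > \<pi> (i + 2)})"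
      by (cases i) (auto simp: left_peaks_def)
  next
    fix i assume "i \<in> Suc ` ({..<n - 1} \<inter> {i. \<pi> (i + 1) > \<pi> (i + 2)})"
    then show "i \<in> left_peaks n \<pi>" using asc[of i] by (auto simp: left_peaks_def)
  qed
  then have "card (left_peaks n \<pi>) = (\<Sum>i<n - 1. of_bool (\<pi> (i + 1) > \<pi> (i + 2)))"
    by (simp add: card_image sum_of_bool_eq)
  also have "\<dots> = descents (map \<pi> [1..<Suc n])"
    unfolding descents_eq_sum by (intro sum.cong) (simp_all del: upt_Suc)
  finally show ?thesis .
qed

lemma Max4_iff: "(a :: 'a::linorder) = Max {a, b, c, d} \<longleftrightarrow> b \<le> a \<and> c \<le> a \<and> d \<le> a"
  by (auto simp: max_def)

lemma Min4_iff: "(d :: 'a::linorder) = Min {a, b, c, d} \<longleftrightarrow> d \<le> a \<and> d \<le> b \<and> d \<le> c"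
  by (auto simp: min_def)

text \<open>The two conditions agree up to an index shift: list indices \<open>i\<close> and
  \<open>j\<close> start the steps that end at positions i + 2 and j + 2, and a list index
  \<open>l\<close> is position l + 1.\<close>

lemma augmented_andre_iff_andre_word:
  assumes n: "n \<ge> 1" and perm: "\<pi> permutes {1..n}"
  shows "\<pi> \<in> augmented_andre_permutations n \<longleftrightarrow> andre_word (map \<pi> [1..<Suc n])"
proof -
  let ?w = "map \<pi> [1..<Suc n]"
  have nth: "?w ! i = \<pi> (i + 1)" if "i < n" for i using that by (simp del: upt_Suc)
  have len: "length ?w = n" by simp
  have set: "set ?w = {1..n}"
    using permutes_image[OF perm] by (simp add: atLeastLessThanSuc_atLeastAtMost del: upt_Suc)
  have last: "last ?w = \<pi> n" using n by simp
  have "\<pi> n \<in> {1..n}" using perm n by (subst permutes_in_image) auto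
  then have last_iff: "(\<forall>x\<in>set ?w. x \<le> last ?w) \<longleftrightarrow> \<pi> n = n"
    unfolding set last using n by (auto intro: antisym)
  show ?thesis
  proof
    assume A: "\<pi> \<in> augmented_andre_permutations n"
    show "andre_word ?w"
      unfolding andre_word_def
    proof (rule conjI, intro allI impI)
      fix i j assume H: "i < j \<and> Suc j < length ?w \<and> ?w ! Suc i \<le> ?w ! i \<and> ?w ! j \<le> ?w ! i \<and>
         ?w ! Suc j \<le> ?w ! i \<and> ?w ! Suc j \<le> ?w ! Suc i \<and> ?w ! Suc j \<le> ?w ! j"
      have ij: "i < j" "Suc j < n" using H len by auto
      have "\<exists>l. i + 2 < l \<and> l < j + 2 \<and> \<pi> l < \<pi> (j + 2)"
      proof -
        have "\<forall>j\<in>{2..n}. \<forall>j'\<in>{2..n}. j < j' \<and>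
            (\<pi> j \<le> \<pi> (j-1) \<and> \<pi> (j'-1) \<le> \<pi> (j-1) \<and> \<pi> j' \<le> \<pi> (j-1)) \<and>
            (\<pi> j' \<le> \<pi> (j-1) \<and> \<pi> j' \<le> \<pi> j \<and> \<pi> j' \<le> \<pi> (j'-1)) \<longrightarrow>
            (\<exists>j''. j < j'' \<and> j'' < j' \<and> \<pi> j'' < \<pi> j')"
          using A unfolding augmented_andre_permutations_def andre_permutation_def Max4_iff Min4_iff by blast
        from this[rule_format, of "i + 2" "j + 2"] show ?thesis
          using H ij nth[of i] nth[of j] nth[of "Suc i"] nth[of "Suc j"] by auto
      qed
      then obtain l where l: "i + 2 < l" "l < j + 2" "\<pi> l < \<pi> (j + 2)" by blast
      then show "\<exists>l. Suc i < l \<and> l \<le> j \<and> ?w ! l < ?w ! Suc j"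
        using nth[of "l - 1"] nth[of "Suc j"] ij by (intro exI[of _ "l - 1"]) auto
    qed (use A last_iff in \<open>simp add: augmented_andre_permutations_def del: upt_Suc\<close>)
  next
    assume A: "andre_word ?w"
    have cond: "\<exists>l. i + 2 < l \<and> l < j + 2 \<and> \<pi> l < \<pi> (j + 2)"
      if H: "i < j" "j + 2 \<le> n" "\<pi> (i + 2) \<le> \<pi> (i + 1)" "\<pi> (j + 1) \<le> \<pi> (i + 1)" "\<pi> (j + 2) \<le> \<pi> (i + 1)"
        "\<pi> (j + 2) \<le> \<pi> (i + 2)" "\<pi> (j + 2) \<le> \<pi> (j + 1)" for i j
    proof -
      obtain l where "Suc i < l" "l \<le> j" "?w ! l < ?w ! Suc j"
        by (rule andre_word_nthD[OF A H(1)])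
          (use H nth[of i] nth[of j] nth[of "Suc i"] nth[of "Suc j"] in \<open>simp_all del: upt_Suc\<close>)
      then show ?thesis
        using nth[of l] nth[of "Suc j"] H by (intro exI[of _ "l + 1"]) auto
    qed
    have "\<pi> n = n" using A last_iff by (simp add: andre_word_def del: upt_Suc)
    \<comment> \<open>A double descent is a pair of adjacent steps, whose witness would have to lie
      strictly between k + 2 and k + 3.\<close>
    moreover have False if i: "i \<in> {2..n-1}" "\<pi> (i-1) > \<pi> i" "\<pi> i > \<pi> (i+1)" for i
    proof -
      obtain k where k: "i = k + 2" using i(1) by (metis atLeastAtMost_iff le_Suc_ex add.commute)
      have "k + 3 \<le> n" using i(1) unfolding k atLeastAtMost_iff by linarith
      then show False using cond[of k "Suc k"] i by (auto simp: k)
    qed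
    moreover have "\<exists>j''. j < j'' \<and> j'' < j' \<and> \<pi> j'' < \<pi> j'"
      if j: "j \<in> {2..n}" "j' \<in> {2..n}" "j < j' \<and>
            (\<pi> j \<le> \<pi> (j-1) \<and> \<pi> (j'-1) \<le> \<pi> (j-1) \<and> \<pi> j' \<le> \<pi> (j-1)) \<and>
            (\<pi> j' \<le> \<pi> (j-1) \<and> \<pi> j' \<le> \<pi> j \<and> \<pi> j' \<le> \<pi> (j'-1))" for j j'
    proof -
      obtain k k' where k: "j = k + 2" "j' = k' + 2"
        using j(1,2) by (metis atLeastAtMost_iff le_Suc_ex add.commute)
      show ?thesis using cond[of k k'] j by (auto simp: k)
    qed
    ultimately show "\<pi> \<in> augmented_andre_permutations n"
      unfolding augmented_andre_permutations_def andre_permutation_def Max4_iff Min4_iff using perm by blast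
  qed
qed

section \<open>From counting numbers to sums over permutations\<close>

lemma sum_card_fibers:
  fixes t :: "nat \<Rightarrow> 'a::comm_semiring_1"
  assumes "finite A" "finite K" "g ` A \<subseteq> K"
  shows "(\<Sum>k\<in>K. of_nat (card {a \<in> A. g a = k}) * t k) = (\<Sum>a\<in>A. t (g a))"
proof -
  have "(\<Sum>a\<in>A. t (g a)) = (\<Sum>k\<in>K. \<Sum>a\<in>{a \<in> A. g a = k}. t (g a))"
    using assms by (rule sum.group[symmetric])
  also have "\<dots> = (\<Sum>k\<in>K. of_nat (card {a \<in> A. g a = k}) * t k)"
    by (intro sum.cong) auto
  finally show ?thesis ..
qed

lemma monom_of_nat: "monom (of_nat c) k = of_nat c * [:0, 1 :: 'a::comm_semiring_1:] ^ k"
  by (simp add: monom_altdef of_nat_poly)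

lemma D_poly_eq_andre_poly:
  assumes "n \<ge> 1"
  shows "D_poly n = andre_poly n"
proof -
  let ?A = "augmented_andre_permutations n"
  have sub: "?A \<subseteq> {\<pi>. \<pi> permutes {1..n}}"
    by (auto simp: augmented_andre_permutations_def andre_permutation_def)
  have fin: "finite ?A" by (rule finite_subset[OF sub]) (simp add: finite_permutations)
  have "card (left_peaks n \<pi>) + 1 \<le> n" for \<pi>
  proof -
    have "left_peaks n \<pi> \<subseteq> {1..n-1}" by (auto simp: left_peaks_def)
    from card_mono[OF finite_atLeastAtMost this] show ?thesis using assms by simp
  qed
  then have "D_poly n = (\<Sum>\<pi>\<in>?A. [:0, 1:] ^ (card (left_peaks n \<pi>) + 1))"
    unfolding D_poly_def d_num_def monom_of_nat
    by (intro sum_card_fibers fin) auto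
  also have "\<dots> = (\<Sum>\<pi>\<in>?A. leaf_weight (map \<pi> [1..<Suc n]))"
  proof (rule sum.cong[OF refl])
    fix \<pi> assume "\<pi> \<in> ?A"
    then have "andre_permutation n \<pi>" by (simp add: augmented_andre_permutations_def)
    then show "[:0, 1:] ^ (card (left_peaks n \<pi>) + 1) = leaf_weight (map \<pi> [1..<Suc n])"
      using assms by (simp add: card_left_peaks leaf_weight_def del: upt_Suc)
  qed
  \<comment> \<open>Extension by zero to all permutations makes the bijection with words
    applicable.\<close>
  also have "\<dots> = (\<Sum>\<pi>\<in>{\<pi>. \<pi> permutes {1..n}}.
      if andre_word (map \<pi> [1..<Suc n]) then leaf_weight (map \<pi> [1..<Suc n]) else 0)"
    using sub assms augmented_andre_iff_andre_word[OF assms]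
    by (intro sum.mono_neutral_cong_left) (auto simp: finite_permutations simp del: upt_Suc)
  also have "\<dots> = (\<Sum>w\<in>permutations_of_set {1..n}. if andre_word w then leaf_weight w else 0)"
    by (rule sum_permutes_words)
  also have "\<dots> = (\<Sum>w\<in>andre_words {1..n}. leaf_weight w)"
    unfolding andre_words_def by (rule sum.inter_filter[symmetric]) simp
  finally show ?thesis by (simp add: sum_andre_words)
qed

lemma run_sum_eq_D_poly:
  assumes "n \<ge> 2"
  shows "(\<Sum>k=1..n-1. of_nat (R_num n k) * [:0, 1:] ^ k * [:1, -1:] ^ (n - 1 - k)) = 2 * D_poly n"
proof -
  let ?P = "{\<pi>. \<pi> permutes {1..n}}" and ?t = "\<lambda>k. [:0, 1:] ^ k * [:1, -1 :: rat:] ^ (n - 1 - k)"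
  have "card (direction_changes n \<pi>) + 2 \<le> n" for \<pi>
    using turns_le[of "map \<pi> [1..<Suc n]"] assms by (simp add: card_direction_changes del: upt_Suc)
  then have le: "card (direction_changes n \<pi>) + 1 \<le> n - 1" for \<pi>
    by (metis Suc_eq_plus1 add_2_eq_Suc' diff_Suc_1 diff_le_mono)
  have "(\<Sum>k=1..n-1. of_nat (R_num n k) * [:0, 1:] ^ k * [:1, -1:] ^ (n - 1 - k)) =
     (\<Sum>k=1..n-1. of_nat (card {\<pi> \<in> ?P. card (direction_changes n \<pi>) + 1 = k}) * ?t k)"
    by (simp add: R_num_def mult.assoc)
  also have "\<dots> = (\<Sum>\<pi>\<in>?P. ?t (card (direction_changes n \<pi>) + 1))"
    using le by (intro sum_card_fibers) (auto simp: finite_permutations)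
  also have "\<dots> = (\<Sum>w\<in>permutations_of_set {1..n}. ?t (turns w + 1))"
    unfolding card_direction_changes by (rule sum_permutes_words)
  also have "\<dots> = 2 * andre_poly n"
    using run_sum_eq_andre_poly[OF assms] by (simp add: numeral_2_eq_2)
  finally show ?thesis using assms by (simp add: D_poly_eq_andre_poly)
qed

subsection \<open>Substitution of a rational function\<close>

text \<open>This Horner step is the basis for the inductions that follow, which show that
  substitution is a ring homomorphism.\<close>

lemma subst_fract_pCons: "subst_fract (pCons a p) f = to_fract [:a:] + f * subst_fract p f"
  by (simp add: subst_fract_def map_poly_pCons)

lemma subst_fract_0: "subst_fract 0 f = 0"
  by (simp add: subst_fract_def)

lemma subst_fract_add: "subst_fract (p + q) f = subst_fract p f + subst_fract q f"
proof (induction p q rule: poly_induct2)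
  case (pCons a p b q)
  have "to_fract [:a + b:] = to_fract [:a:] + to_fract [:b:]"
    by (simp flip: to_fract_add)
  with pCons show ?case by (simp add: subst_fract_pCons algebra_simps)
qed (simp add: subst_fract_0)

lemma subst_fract_smult: "subst_fract (smult c p) f = to_fract [:c:] * subst_fract p f"
proof (induction p)
  case (pCons a p)
  have "to_fract [:c * a:] = to_fract [:c:] * to_fract [:a:]"
    by (simp flip: to_fract_mult)
  with pCons show ?case by (simp add: subst_fract_pCons algebra_simps)
qed (simp add: subst_fract_0)

lemma subst_fract_mult: "subst_fract (p * q) f = subst_fract p f * subst_fract q f"
  by (induction p)
    (simp_all add: subst_fract_0 mult_pCons_left subst_fract_add subst_fract_smult subst_fract_pCons algebra_simps)

lemma subst_fract_1: "subst_fract 1 f = 1"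
  by (simp add: one_pCons subst_fract_pCons subst_fract_0) (simp flip: one_pCons)

lemma subst_fract_of_nat: "subst_fract (of_nat n) f = of_nat n"
  by (induction n) (simp_all add: subst_fract_0 subst_fract_1 subst_fract_add)

lemma subst_fract_power: "subst_fract (p ^ n) f = subst_fract p f ^ n"
  by (induction n) (simp_all add: subst_fract_1 subst_fract_mult)

lemma subst_fract_sum: "subst_fract (\<Sum>x\<in>A. p x) f = (\<Sum>x\<in>A. subst_fract (p x) f)"
  by (induction A rule: infinite_finite_induct) (simp_all add: subst_fract_0 subst_fract_add)

lemma subst_fract_X: "subst_fract [:0, 1:] f = f"
  by (simp add: subst_fract_pCons subst_fract_0 subst_fract_1 flip: one_pCons)

lemma to_fract_of_nat: "to_fract (of_nat n) = of_nat n"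
  by (induction n) simp_all

lemma to_fract_power: "to_fract (p ^ n) = to_fract p ^ n"
  by (induction n) simp_all

theorem theorem10:
  fixes n :: nat
  assumes "n \<ge> 2"
  shows "D_poly n =
           smult (1/2) (\<Sum>k=1..n-1. of_nat (R_num n k) * [:0, 1:] ^ k * [:1, -1:] ^ (n - 1 - k))
         \<and>
         to_fract (R_poly n) =
           2 * (1 + fract_X) ^ (n - 1) * subst_fract (D_poly n) (fract_X / (1 + fract_X))"
proof
  show "D_poly n =
      smult (1/2) (\<Sum>k=1..n-1. of_nat (R_num n k) * [:0, 1:] ^ k * [:1, -1:] ^ (n - 1 - k))"
    unfolding run_sum_eq_D_poly[OF assms] by (simp add: numeral_poly)
next
  define X where "X = fract_X"
  define y where "y = X / (1 + X)"
  have "1 + X = to_fract [:1, 1:]"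
    unfolding X_def fract_X_def by (simp add: one_pCons flip: to_fract_add to_fract_1)
  then have nz: "1 + X \<noteq> 0" by simp
  \<comment> \<open>These two products drive the conversion: multiplied by 1 + X, the substituted
    values of x and 1 - x become X and 1.\<close>
  then have y: "(1 + X) * y = X" "(1 + X) * (1 - y) = 1"
    by (simp_all add: y_def field_simps)
  have "[:1, -1:] + [:0, 1:] = (1 :: rat poly)"
    by (simp add: one_pCons)
  then have "subst_fract ([:1, -1:] + [:0, 1:]) y = 1"
    by (simp only: subst_fract_1)
  then have sY: "subst_fract [:1, -1:] y = 1 - y"
    unfolding subst_fract_add subst_fract_X by (simp add: algebra_simps)
  have "2 * subst_fract (D_poly n) y = subst_fract (2 * D_poly n) y"
    using subst_fract_of_nat[of 2 y] by (simp add: subst_fract_mult)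
  also have "\<dots> = (\<Sum>k=1..n-1. of_nat (R_num n k) * y ^ k * (1 - y) ^ (n - 1 - k))"
    unfolding run_sum_eq_D_poly[OF assms, symmetric]
    by (simp add: subst_fract_sum subst_fract_mult subst_fract_power subst_fract_of_nat subst_fract_X sY)
  finally have double: "2 * subst_fract (D_poly n) y =
      (\<Sum>k=1..n-1. of_nat (R_num n k) * y ^ k * (1 - y) ^ (n - 1 - k))" .
  have "2 * (1 + X) ^ (n - 1) * subst_fract (D_poly n) y = (1 + X) ^ (n - 1) * (2 * subst_fract (D_poly n) y)"
    by (simp only: mult_ac)
  also have "\<dots> = (\<Sum>k=1..n-1. (1 + X) ^ (n - 1) * (of_nat (R_num n k) * y ^ k * (1 - y) ^ (n - 1 - k)))"
    unfolding double by (rule sum_distrib_left)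
  also have "\<dots> = (\<Sum>k=1..n-1. of_nat (R_num n k) * X ^ k)"
  proof (rule sum.cong[OF refl])
    fix k assume "k \<in> {1..n-1}"
    \<comment> \<open>Of the n - 1 factors 1 + X, \<open>k\<close> are paired with the powers of
      \<open>y\<close> and the rest with the powers of 1 - y.\<close>
    then have "k + (n - 1 - k) = n - 1" by auto
    then have "(1 + X) ^ (n - 1) = (1 + X) ^ k * (1 + X) ^ (n - 1 - k)"
      by (metis power_add)
    then have "(1 + X) ^ (n - 1) * (of_nat (R_num n k) * y ^ k * (1 - y) ^ (n - 1 - k)) =
       of_nat (R_num n k) * ((1 + X) * y) ^ k * ((1 + X) * (1 - y)) ^ (n - 1 - k)"
      unfolding power_mult_distrib by (simp only: mult_ac)
    then show "(1 + X) ^ (n - 1) * (of_nat (R_num n k) * y ^ k * (1 - y) ^ (n - 1 - k)) = of_nat (R_num n k) * X ^ k"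
      by (simp add: y)
  qed
  also have "\<dots> = to_fract (R_poly n)"
    unfolding R_poly_def monom_of_nat
    by (simp add: to_fract_of_nat to_fract_power X_def fract_X_def)
  finally show "to_fract (R_poly n) =
      2 * (1 + fract_X) ^ (n - 1) * subst_fract (D_poly n) (fract_X / (1 + fract_X))"
    by (simp add: X_def y_def)
qed

end
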